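(* Fix $b\ge 2$, $n\ge 2$, $m\ge 1$. Add $n$ base-$b$ numbers of length $m$ whose digits are independent and uniform on $\{0,\dots,b-1\}$, and let $\kappa_j$ be the carry from column $j$ to column $j+1$ (columns numbered from the right; $\kappa_0=0$, $\kappa_j=\lfloor(\kappa_{j-1}+s_j)/b\rfloor$ with $s_j$ the sum of the digits in column $j$). Then for $1\le j\le m$, $\mathbb{E}[\kappa_j]=\mu_j=\frac{n-1}{2}\left(1-\frac{1}{b^j}\right)$ and $\mathrm{Var}(\kappa_j)=\sigma_j^2=\frac{n+1}{12}\left(1-\frac{1}{b^{2j}}\right)$. Moreover, $(\kappa_j-\mu_j)/\sigma_j$ converges in distribution to a standard normal random variable as $n\to\infty$. *)

theory Defs
  imports "HOL-Probability.Probability"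
begin

text \<open>
  \<open>D i k\<close> is the digit of the \<open>i\<close>-th summand (\<open>i < n\<close>) in column \<open>k\<close>; columns run from
  1 (the rightmost) to \<open>m\<close>.
\<close>
definition uniform_digits ::
  "nat \<Rightarrow> nat \<Rightarrow> nat \<Rightarrow> 'a measure \<Rightarrow> (nat \<Rightarrow> nat \<Rightarrow> 'a \<Rightarrow> nat) \<Rightarrow> bool" where
  "uniform_digits b n m M D \<longleftrightarrow>
     prob_space M \<and>
     prob_space.indep_vars M (\<lambda>_. count_space UNIV) (\<lambda>(i, k). D i k) ({..<n} \<times> {1..m}) \<and>
     (\<forall>i<n. \<forall>k\<in>{1..m}. distr M (count_space UNIV) (D i k) = measure_pmf (pmf_of_set {0..<b}))"

primrec carry :: "nat \<Rightarrow> nat \<Rightarrow> (nat \<Rightarrow> nat \<Rightarrow> nat) \<Rightarrow> nat \<Rightarrow> nat" where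
  "carry b n d 0 = 0"
| "carry b n d (Suc j) = (carry b n d j + (\<Sum>i<n. d i (Suc j))) div b"

definition rcarry ::
  "nat \<Rightarrow> nat \<Rightarrow> (nat \<Rightarrow> nat \<Rightarrow> 'a \<Rightarrow> nat) \<Rightarrow> nat \<Rightarrow> 'a \<Rightarrow> real" where
  "rcarry b n D j \<omega> = real (carry b n (\<lambda>i k. D i k \<omega>) j)"

definition carry_mean :: "nat \<Rightarrow> nat \<Rightarrow> nat \<Rightarrow> real" where
  "carry_mean b n j = (real n - 1) / 2 * (1 - 1 / real b ^ j)"

definition carry_var :: "nat \<Rightarrow> nat \<Rightarrow> nat \<Rightarrow> real" where
  "carry_var b n j = (real n + 1) / 12 * (1 - 1 / real b ^ (2 * j))"

end

theory Submission
  imports Defs "HOL-Real_Asymp.Real_Asymp"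
begin

text \<open>
  Reading the last \<open>j\<close> digits of each summand as a number \<open>X i\<close> gives independent variables
  uniform on \<open>{..<N}\<close> with \<open>N = b ^ j\<close>, and the carry is \<open>S div N = (S - R) / N\<close>, where \<open>S\<close> is
  the sum of the \<open>X i\<close> and \<open>R = S mod N\<close>. As soon as \<open>n \<ge> 2\<close>, the remainder \<open>R\<close> is uniform and
  independent of each single \<open>X i\<close>, hence uncorrelated with \<open>S\<close>. So the variance of the carry is
  that of \<open>n + 1\<close> uncorrelated uniform variables, divided by \<open>N\<^sup>2\<close>. Since \<open>R\<close> is bounded, it
  disappears in the limit, and the central limit theorem for \<open>S\<close> gives asymptotic normality.
\<close>

section \<open>Uniform random variables on finite sets and their joint laws\<close>

text \<open>The law is given by \<open>pmf_of_set\<close>, so that images and pairs reduce to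
  bijections and products of pmfs. Measurability is recorded separately, since an equation about
  \<open>distr\<close> does not state it.\<close>

definition uniform_rv :: "'a measure \<Rightarrow> 'c set \<Rightarrow> ('a \<Rightarrow> 'c) \<Rightarrow> bool" where
  "uniform_rv M A X \<longleftrightarrow> X \<in> measurable M (count_space UNIV) \<and>
     distr M (count_space UNIV) X = measure_pmf (pmf_of_set A)"

lemma uniform_rv_measurable: "uniform_rv M A X \<Longrightarrow> X \<in> measurable M (count_space UNIV)"
  by (simp add: uniform_rv_def)

lemma uniform_rv_compose:
  assumes "uniform_rv M A X" "map_pmf f (pmf_of_set A) = pmf_of_set B"
  shows "uniform_rv M B (\<lambda>\<omega>. f (X \<omega>))"
proof -
  have X[measurable]: "X \<in> measurable M (count_space UNIV)"
    and d: "distr M (count_space UNIV) X = measure_pmf (pmf_of_set A)"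
    using assms(1) by (auto simp: uniform_rv_def)
  have "distr M (count_space UNIV) (\<lambda>\<omega>. f (X \<omega>))
      = distr (distr M (count_space UNIV) X) (count_space UNIV) f"
    by (subst distr_distr) (auto simp: comp_def)
  also have "\<dots> = measure_pmf (pmf_of_set B)"
    by (simp add: d flip: assms(2) map_pmf_rep_eq)
  finally show ?thesis
    using measurable_compose[OF X, of f "count_space UNIV"] by (simp add: uniform_rv_def)
qed

lemma uniform_rv_bij:
  assumes "uniform_rv M A X" "bij_betw f A B" "finite A" "A \<noteq> {}"
  shows "uniform_rv M B (\<lambda>\<omega>. f (X \<omega>))"
  by (rule uniform_rv_compose[OF assms(1) map_pmf_of_set_bij_betw]) (use assms in auto)

lemma pmf_of_set_Times:
  assumes "finite A" "A \<noteq> {}" "finite B" "B \<noteq> {}"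
  shows "pmf_of_set (A \<times> B) = pair_pmf (pmf_of_set A) (pmf_of_set B)"
proof (rule pmf_eqI)
  fix z :: "'a \<times> 'b"
  obtain x y where z: "z = (x, y)" by (cases z)
  have "A \<times> B \<noteq> {}" "finite (A \<times> B)" using assms by auto
  then show "pmf (pmf_of_set (A \<times> B)) z = pmf (pair_pmf (pmf_of_set A) (pmf_of_set B)) z"
    using assms by (simp add: z pmf_pair indicator_def)
qed

lemma uniform_rv_snd:
  assumes "uniform_rv M (A \<times> B) X" "finite A" "A \<noteq> {}" "finite B" "B \<noteq> {}"
  shows "uniform_rv M B (\<lambda>\<omega>. snd (X \<omega>))"
  by (rule uniform_rv_compose[OF assms(1)]) (use assms in \<open>simp add: pmf_of_set_Times map_snd_pair_pmf\<close>)

text \<open>Independence makes the joint law a product measure. Over a countable type the product of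
  count spaces is again a count space, so this law can be compared with \<open>pair_pmf\<close>
  point by point.\<close>

lemma uniform_rv_pair:
  fixes X :: "'a \<Rightarrow> 'c :: countable" and Y :: "'a \<Rightarrow> 'c"
  assumes X: "uniform_rv M A X" and Y: "uniform_rv M B Y"
    and M: "prob_space M" and ind: "prob_space.indep_var M (count_space UNIV) X (count_space UNIV) Y"
    and A: "finite A" "A \<noteq> {}" and B: "finite B" "B \<noteq> {}"
  shows "uniform_rv M (A \<times> B) (\<lambda>\<omega>. (X \<omega>, Y \<omega>))"
proof -
  interpret prob_space M by (rule M)
  let ?p = "measure_pmf (pmf_of_set A)" and ?q = "measure_pmf (pmf_of_set B)"
  have C: "(count_space UNIV :: 'c measure) \<Otimes>\<^sub>M (count_space UNIV :: 'c measure) = count_space UNIV"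
    by (simp add: pair_measure_countable)
  have sp: "sets (?p \<Otimes>\<^sub>M ?q) = UNIV"
    using sets_pair_measure_cong[OF sets_measure_pmf_count_space[of "pmf_of_set A"] sets_measure_pmf_count_space[of "pmf_of_set B"]]
    unfolding C by simp
  have "distr M (count_space UNIV) (\<lambda>\<omega>. (X \<omega>, Y \<omega>)) = ?p \<Otimes>\<^sub>M ?q"
    using ind X Y unfolding indep_var_distribution_eq by (simp add: C uniform_rv_def)
  also have "\<dots> = measure_pmf (pair_pmf (pmf_of_set A) (pmf_of_set B))"
  proof (rule measure_eqI_countable[where A = UNIV])
    fix z :: "'c \<times> 'c"
    obtain x y where z: "z = (x, y)" by (cases z)
    have "emeasure (?p \<Otimes>\<^sub>M ?q) ({x} \<times> {y}) = emeasure ?p {x} * emeasure ?q {y}"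
      by (intro measure_pmf.emeasure_pair_measure_Times) auto
    then show "emeasure (?p \<Otimes>\<^sub>M ?q) {z} = emeasure (measure_pmf (pair_pmf (pmf_of_set A) (pmf_of_set B))) {z}"
      by (simp add: z emeasure_pmf_single pmf_pair ennreal_mult)
  qed (auto simp: sp)
  finally show ?thesis
    using ind unfolding indep_var_distribution_eq
    by (auto simp: uniform_rv_def pmf_of_set_Times A B C)
qed

lemma uniform_rv_expectation:
  fixes f :: "'c \<Rightarrow> real"
  assumes "uniform_rv M A X" "finite A" "A \<noteq> {}"
  shows "integrable M (\<lambda>\<omega>. f (X \<omega>))"
    and "integral\<^sup>L M (\<lambda>\<omega>. f (X \<omega>)) = (\<Sum>x\<in>A. f x) / real (card A)"
proof -
  have X[measurable]: "X \<in> measurable M (count_space UNIV)"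
    and d: "distr M (count_space UNIV) X = measure_pmf (pmf_of_set A)"
    using assms(1) by (auto simp: uniform_rv_def)
  have "integrable (distr M (count_space UNIV) X) f"
    unfolding d by (rule integrable_measure_pmf_finite) (use assms in simp)
  then show "integrable M (\<lambda>\<omega>. f (X \<omega>))" by (subst (asm) integrable_distr_eq) auto
  have "integral\<^sup>L M (\<lambda>\<omega>. f (X \<omega>)) = integral\<^sup>L (distr M (count_space UNIV) X) f"
    by (subst integral_distr) auto
  then show "integral\<^sup>L M (\<lambda>\<omega>. f (X \<omega>)) = (\<Sum>x\<in>A. f x) / real (card A)"
    by (simp add: d integral_pmf_of_set assms)
qed

text \<open>Restrictions of an independent family to disjoint blocks are independent. Finite blocks
  and a countable codomain turn the product spaces into count spaces, where every \<open>f\<close>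
  and \<open>g\<close> is measurable.\<close>

lemma (in prob_space) indep_var_groups:
  fixes X :: "'i \<Rightarrow> 'a \<Rightarrow> 'c :: countable"
  assumes ind: "indep_vars (\<lambda>_. count_space UNIV) X I"
    and AB: "A \<inter> B = {}" "A \<subseteq> I" "B \<subseteq> I" "finite A" "finite B"
  shows "indep_var (count_space UNIV) (\<lambda>\<omega>. f (restrict (\<lambda>i. X i \<omega>) A))
                   (count_space UNIV) (\<lambda>\<omega>. g (restrict (\<lambda>i. X i \<omega>) B))"
proof -
  have "indep_var (count_space UNIV) (f \<circ> (\<lambda>\<omega>. restrict (\<lambda>i. X i \<omega>) A))
                  (count_space UNIV) (g \<circ> (\<lambda>\<omega>. restrict (\<lambda>i. X i \<omega>) B))"
    by (rule indep_var_compose[OF indep_var_restrict[OF ind AB(1-3)]])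
       (use AB in \<open>auto simp: count_space_PiM_finite\<close>)
  then show ?thesis by (simp add: comp_def)
qed

section \<open>Bijections on residues, and sums modulo \<open>N\<close>\<close>

text \<open>Division with remainder is the inverse. With \<open>a = b ^ j\<close> and
  \<open>c = b\<close> the map puts one new leading digit in front of \<open>j\<close> lower
  ones.\<close>

lemma bij_betw_digit:
  fixes a c :: nat
  shows "bij_betw (\<lambda>(x, t). x + a * t) ({..<a} \<times> {..<c}) {..<a * c}"
proof (rule bij_betw_byWitness[where f' = "\<lambda>y. (y mod a, y div a)"])
  show "(\<lambda>(x, t). x + a * t) ` ({..<a} \<times> {..<c}) \<subseteq> {..<a * c}"
  proof safe
    fix x t assume "x < a" "t < c"
    then have "x + a * t < a * Suc t" "a * Suc t \<le> a * c"
      by (simp, intro mult_le_mono2, simp)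
    then show "x + a * t < a * c" by linarith
  qed
  show "(\<lambda>y. (y mod a, y div a)) ` {..<a * c} \<subseteq> {..<a} \<times> {..<c}"
    by (auto simp: less_mult_imp_div_less mult.commute intro!: mod_less_divisor gr0I)
qed auto

text \<open>For fixed \<open>x\<close> the second coordinate is rotated cyclically. Keeping
  \<open>x\<close> as first coordinate is what later makes the remainder of a sum independent of a
  single summand.\<close>

lemma bij_betw_shift_mod:
  fixes N :: nat
  shows "bij_betw (\<lambda>(x, t). (x, (x + t) mod N)) ({..<N} \<times> {..<N}) ({..<N} \<times> {..<N})"
proof -
  have "inj_on (\<lambda>(x, t). (x, (x + t) mod N)) ({..<N} \<times> {..<N})"
  proof (rule inj_onI, safe)
    fix x t u assume *: "x < N" "t < N" "u < N" "(x + t) mod N = (x + u) mod N"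
    \<comment> \<open>Adding \<open>N - x\<close> cancels \<open>x\<close> modulo \<open>N\<close>
      while staying inside the naturals.\<close>
    have h: "((x + t) + (N - x)) mod N = ((x + u) + (N - x)) mod N"
      using *(4) by (rule mod_add_cong) simp
    have e: "(x + t) + (N - x) = t + N" "(x + u) + (N - x) = u + N" using * by auto
    have "(t + N) mod N = (u + N) mod N" using h unfolding e .
    then show "t = u" using * by simp
  qed
  then show ?thesis
    by (intro bij_betw_imageI endo_inj_surj) auto
qed

text \<open>A uniform residue rotated by an independent amount stays uniform, whatever that amount
  is. The second claim asks for \<open>A \<noteq> {i}\<close> because the remainder of
  \<open>X i\<close> alone is a function of \<open>X i\<close>.\<close>

lemma uniform_rv_sum_mod:
  fixes X :: "'i \<Rightarrow> 'a \<Rightarrow> nat"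
  assumes M: "prob_space M" and ind: "prob_space.indep_vars M (\<lambda>_. count_space UNIV) X I"
    and unif: "\<And>i. i \<in> I \<Longrightarrow> uniform_rv M {..<N} (X i)"
    and A: "finite A" "A \<noteq> {}" "A \<subseteq> I" and N: "N > 0"
  shows "uniform_rv M {..<N} (\<lambda>\<omega>. (\<Sum>i\<in>A. X i \<omega>) mod N)"
    and "i \<in> A \<Longrightarrow> A \<noteq> {i} \<Longrightarrow>
      uniform_rv M ({..<N} \<times> {..<N}) (\<lambda>\<omega>. (X i \<omega>, (\<Sum>i\<in>A. X i \<omega>) mod N))"
proof -
  interpret prob_space M by (rule M)
  have ne: "{..<N} \<noteq> {}" using N by auto
  \<comment> \<open>\<open>X i\<close> and the remainder over \<open>B\<close> form a uniform pair
    on the square, and \<open>bij_betw_shift_mod\<close> maps it to the desired pair. The induction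
    in \<open>main\<close> keeps only its second coordinate.\<close>
  have step: "uniform_rv M ({..<N} \<times> {..<N}) (\<lambda>\<omega>. (X i \<omega>, (\<Sum>i\<in>insert i B. X i \<omega>) mod N))"
    if B: "finite B" "i \<notin> B" "insert i B \<subseteq> I" and u: "uniform_rv M {..<N} (\<lambda>\<omega>. (\<Sum>i\<in>B. X i \<omega>) mod N)"
    for i B
  proof -
    have "indep_var (count_space UNIV) (\<lambda>\<omega>. (restrict (\<lambda>i. X i \<omega>) {i}) i)
            (count_space UNIV) (\<lambda>\<omega>. (\<Sum>i\<in>B. restrict (\<lambda>i. X i \<omega>) B i) mod N)"
      by (rule indep_var_groups[OF ind, where f = "\<lambda>x. x i" and g = "\<lambda>x. (\<Sum>i\<in>B. x i) mod N"]) (use B in auto)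
    then have "indep_var (count_space UNIV) (X i) (count_space UNIV) (\<lambda>\<omega>. (\<Sum>i\<in>B. X i \<omega>) mod N)"
      by simp
    from uniform_rv_bij[OF uniform_rv_pair[OF unif u M this] bij_betw_shift_mod] B ne
    show ?thesis by (simp add: mod_add_right_eq)
  qed
  have main: "uniform_rv M {..<N} (\<lambda>\<omega>. (\<Sum>i\<in>A. X i \<omega>) mod N)"
    if "finite A" "A \<noteq> {}" "A \<subseteq> I" for A
    using that
  proof (induction A rule: finite_ne_induct)
    case (singleton i)
    show ?case
      using uniform_rv_bij[OF unif, of i "\<lambda>x. x mod N" "{..<N}"] singleton ne
      by (auto simp: bij_betw_def inj_on_def image_def)
  next
    case (insert i B)
    from uniform_rv_snd[OF step[of B i]] insert ne show ?case by simp
  qed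
  from main[OF A] show "uniform_rv M {..<N} (\<lambda>\<omega>. (\<Sum>i\<in>A. X i \<omega>) mod N)" .
  assume i: "i \<in> A" "A \<noteq> {i}"
  have "insert i (A - {i}) = A" using i by auto
  with step[of "A - {i}" i] main[of "A - {i}"] A i
  show "uniform_rv M ({..<N} \<times> {..<N}) (\<lambda>\<omega>. (X i \<omega>, (\<Sum>i\<in>A. X i \<omega>) mod N))"
    by auto
qed


section \<open>The carry as a quotient, and rows of digits as uniform numbers\<close>

text \<open>The new column adds a multiple of \<open>b ^ j\<close>, which passes through division by
  \<open>b ^ j\<close> as an exact summand; dividing by \<open>b ^ j\<close> and then by
  \<open>b\<close> is dividing by \<open>b ^ Suc j\<close>.\<close>

lemma carry_eq_div:
  assumes "b > 0"
  shows "carry b n d j = (\<Sum>i<n. \<Sum>k\<in>{1..j}. d i k * b ^ (k - 1)) div b ^ j"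
proof (induction j)
  case (Suc j)
  let ?S = "\<Sum>i<n. \<Sum>k\<in>{1..j}. d i k * b ^ (k - 1)" and ?s = "\<Sum>i<n. d i (Suc j)"
  have "(\<Sum>i<n. \<Sum>k\<in>{1..Suc j}. d i k * b ^ (k - 1)) = ?S + b ^ j * ?s"
    by (simp add: sum.distrib sum_distrib_left mult.commute)
  moreover have "(?S + b ^ j * ?s) div b ^ Suc j = ((?S + b ^ j * ?s) div b ^ j) div b"
    by (simp add: div_mult2_eq mult.commute[of b])
  ultimately show ?case using Suc assms by (simp add: add.commute)
qed simp

text \<open>Induction on the number of digits: the number formed by the lower digits is independent
  of the next digit, and \<open>bij_betw_digit\<close> merges the two.\<close>

lemma uniform_rv_digits:
  fixes X :: "nat \<Rightarrow> 'a \<Rightarrow> nat"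
  assumes M: "prob_space M" and b: "b > 0"
    and ind: "prob_space.indep_vars M (\<lambda>_. count_space UNIV) X {1..j}"
    and unif: "\<And>k. k \<in> {1..j} \<Longrightarrow> uniform_rv M {..<b} (X k)"
  shows "uniform_rv M {..<b ^ j} (\<lambda>\<omega>. \<Sum>k\<in>{1..j}. X k \<omega> * b ^ (k - 1))"
  using ind unif
proof (induction j)
  case 0
  interpret prob_space M by (rule M)
  \<comment> \<open>The empty sum is the constant 0, which is uniform on the one-point set
    \<open>{..<b ^ 0}\<close>.\<close>
  have "distr M (count_space UNIV) (\<lambda>\<omega>. 0::nat) = return (count_space UNIV) 0"
    by (rule distr_const) simp
  moreover have "{..<Suc 0} = {0}" by auto
  ultimately show ?case by (simp add: uniform_rv_def pmf_of_set_singleton return_pmf.rep_eq)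
next
  case (Suc j)
  interpret prob_space M by (rule M)
  let ?Y = "\<lambda>\<omega>. \<Sum>k\<in>{1..j}. X k \<omega> * b ^ (k - 1)"
  have ind': "indep_vars (\<lambda>_. count_space UNIV) X {1..j}"
    by (rule indep_vars_subset[OF Suc.prems(1)]) auto
  have u: "uniform_rv M {..<b ^ j} ?Y"
    by (rule Suc.IH[OF ind']) (use Suc.prems(2) in auto)
  have v: "uniform_rv M {..<b} (X (Suc j))" by (rule Suc.prems) auto
  have "indep_var (count_space UNIV)
          (\<lambda>\<omega>. \<Sum>k\<in>{1..j}. (restrict (\<lambda>k. X k \<omega>) {1..j}) k * b ^ (k - 1))
        (count_space UNIV) (\<lambda>\<omega>. (restrict (\<lambda>k. X k \<omega>) {Suc j}) (Suc j))"
    by (rule indep_var_groups[OF Suc.prems(1), where f = "\<lambda>x. \<Sum>k\<in>{1..j}. x k * b ^ (k - 1)"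
          and g = "\<lambda>x. x (Suc j)"]) auto
  then have "indep_var (count_space UNIV) ?Y (count_space UNIV) (X (Suc j))"
    by simp
  from uniform_rv_bij[OF uniform_rv_pair[OF u v M this] bij_betw_digit] b
  show ?case by (auto simp: mult.commute lessThan_empty_iff)
qed

text \<open>The blocks \<open>{i} \<times> {1..j}\<close> are disjoint for different
  \<open>i\<close>, so the row numbers inherit independence from the doubly indexed digits.\<close>

lemma uniform_digits_rows:
  assumes ud: "uniform_digits b n m M D" and b: "b > 0" and j: "j \<le> m"
  defines "X \<equiv> \<lambda>i \<omega>. \<Sum>k\<in>{1..j}. D i k \<omega> * b ^ (k - 1)"
  shows "prob_space M"
    and "prob_space.indep_vars M (\<lambda>_. count_space UNIV) X {..<n}"
    and "i < n \<Longrightarrow> uniform_rv M {..<b ^ j} (X i)"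
proof -
  show M: "prob_space M" using ud by (simp add: uniform_digits_def)
  interpret prob_space M by (rule M)
  have ind: "indep_vars (\<lambda>_. count_space UNIV) (\<lambda>(i, k). D i k) ({..<n} \<times> {1..m})"
    using ud by (simp add: uniform_digits_def)
  have "indep_vars (\<lambda>i. PiM ({i} \<times> {1..j}) (\<lambda>_. count_space UNIV))
          (\<lambda>i \<omega>. restrict (\<lambda>p. (case p of (i, k) \<Rightarrow> D i k) \<omega>) ({i} \<times> {1..j})) {..<n}"
    by (rule indep_vars_restrict[OF ind]) (use j in \<open>auto simp: disjoint_family_on_def\<close>)
  then have "indep_vars (\<lambda>_. count_space UNIV) (\<lambda>i \<omega>. (\<lambda>x. \<Sum>k\<in>{1..j}. x (i, k) * b ^ (k - 1))
          (restrict (\<lambda>p. (case p of (i, k) \<Rightarrow> D i k) \<omega>) ({i} \<times> {1..j}))) {..<n}"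
    by (rule indep_vars_compose2) (auto simp: count_space_PiM_finite)
  then show "indep_vars (\<lambda>_. count_space UNIV) X {..<n}" by (simp add: X_def)
  assume i: "i < n"
  \<comment> \<open>Singleton blocks \<open>{(i, k)}\<close> reindex the digits of row
    \<open>i\<close> by the column alone.\<close>
  have "indep_vars (\<lambda>_. count_space UNIV) (\<lambda>k. (\<lambda>(i, k). D i k) (i, k)) {1..j}"
  proof -
    have "indep_vars (\<lambda>k. PiM {(i, k)} (\<lambda>_. count_space UNIV))
            (\<lambda>k \<omega>. restrict (\<lambda>p. (case p of (i, k) \<Rightarrow> D i k) \<omega>) {(i, k)}) {1..j}"
      by (rule indep_vars_restrict[OF ind]) (use i j in \<open>auto simp: disjoint_family_on_def\<close>)
    then have "indep_vars (\<lambda>_. count_space UNIV) (\<lambda>k \<omega>. (\<lambda>x. x (i, k))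
            (restrict (\<lambda>p. (case p of (i, k) \<Rightarrow> D i k) \<omega>) {(i, k)})) {1..j}"
      by (rule indep_vars_compose2) auto
    then show ?thesis by simp
  qed
  then show "uniform_rv M {..<b ^ j} (X i)"
    unfolding X_def
  proof (intro uniform_rv_digits[OF M b])
    fix k assume k: "k \<in> {1..j}"
    have "D i k \<in> measurable M (count_space UNIV)"
      using ind i k j unfolding indep_vars_def2 by fastforce
    then show "uniform_rv M {..<b} (D i k)"
      using ud i k j by (auto simp: uniform_digits_def uniform_rv_def atLeast0LessThan)
  qed auto
qed

section \<open>Centred power sums\<close>

lemma sum_lessThan_real: "(\<Sum>x<N. real x) = real N * (real N - 1) / 2"
  by (induction N) (auto simp: field_simps)

lemma sum_centred: "(\<Sum>x<N. real x - (real N - 1) / 2) = 0"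
  by (simp add: sum_subtractf sum_lessThan_real)

lemma sum_centred_squares: "(\<Sum>x<N. (real x - (real N - 1) / 2)\<^sup>2) = real N * ((real N)\<^sup>2 - 1) / 12"
proof -
  have sq: "(\<Sum>x<N. (real x)\<^sup>2) = real N * (real N - 1) * (2 * real N - 1) / 6"
    by (induction N) (auto simp: field_simps power2_eq_square)
  have "(\<Sum>x<N. (real x - c)\<^sup>2) = (\<Sum>x<N. (real x)\<^sup>2) - 2 * c * (\<Sum>x<N. real x) + real N * c\<^sup>2" for c
    by (simp add: power2_diff sum.distrib sum_subtractf sum_distrib_left ac_simps)
  from this[of "(real N - 1) / 2"] show ?thesis
    unfolding sq sum_lessThan_real by (simp add: field_simps power2_eq_square)
qed

section \<open>Characteristic functions and the central limit theorem\<close>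

text \<open>Factoring out \<open>iexp b\<close>, which has modulus 1, leaves the Taylor bound of
  order zero for \<open>iexp (a - b)\<close>.\<close>

lemma cmod_iexp_diff_le: "cmod (iexp a - iexp b) \<le> \<bar>a - b\<bar>"
proof -
  have "iexp a - iexp b = iexp b * (iexp (a - b) - 1)"
    by (simp add: algebra_simps flip: exp_add)
  then have "cmod (iexp a - iexp b) = cmod (iexp (a - b) - 1)"
    by (simp add: norm_mult)
  also have "\<dots> \<le> \<bar>a - b\<bar>" using iexp_approx1[of "a - b" 0] by simp
  finally show ?thesis .
qed

text \<open>Both variables live on one space, so the pointwise Lipschitz bound can be integrated.
  This is the tool that removes the bounded remainder from the carry.\<close>

lemma (in prob_space) char_distr_diff_le:
  assumes [measurable]: "random_variable borel Y" "random_variable borel Z"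
    and bound: "\<And>\<omega>. \<omega> \<in> space M \<Longrightarrow> \<bar>Y \<omega> - Z \<omega>\<bar> \<le> c"
  shows "cmod (char (distr M borel Y) t - char (distr M borel Z) t) \<le> \<bar>t\<bar> * c"
proof -
  have int: "integrable M (\<lambda>\<omega>. iexp (t * X \<omega>))" if "random_variable borel X" for X
    using that by (intro integrable_const_bound[where B = 1]) auto
  have "char (distr M borel Y) t - char (distr M borel Z) t
      = (CLINT \<omega>|M. iexp (t * Y \<omega>) - iexp (t * Z \<omega>))"
    unfolding char_def
    by (subst Bochner_Integration.integral_diff[OF int int]) (simp_all add: integral_distr)
  also have "cmod \<dots> \<le> (LINT \<omega>|M. cmod (iexp (t * Y \<omega>) - iexp (t * Z \<omega>)))"
    by (rule integral_norm_bound)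
  also have "\<dots> \<le> (LINT \<omega>|M. \<bar>t\<bar> * c)"
  proof (rule integral_mono)
    fix \<omega> assume "\<omega> \<in> space M"
    then have "\<bar>t * Y \<omega> - t * Z \<omega>\<bar> \<le> \<bar>t\<bar> * c"
      using bound by (simp add: abs_mult mult_left_mono flip: right_diff_distrib)
    then show "cmod (iexp (t * Y \<omega>) - iexp (t * Z \<omega>)) \<le> \<bar>t\<bar> * c"
      using cmod_iexp_diff_le[of "t * Y \<omega>" "t * Z \<omega>"] by simp
  qed (intro integrable_norm Bochner_Integration.integrable_diff int assms(1,2), simp)
  finally show ?thesis by (simp add: prob_space)
qed

text \<open>Independence gives a product of \<open>n\<close> equal factors, and division by
  \<open>s\<close> rescales the argument. The right-hand side no longer refers to the space
  \<open>M\<close>.\<close>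

lemma (in prob_space) char_distr_iid_sum:
  fixes X :: "nat \<Rightarrow> 'a \<Rightarrow> real"
  assumes ind: "indep_vars (\<lambda>_. borel) X {..<n}" and d: "\<And>i. i < n \<Longrightarrow> distr M borel (X i) = \<nu>"
  shows "char (distr M borel (\<lambda>\<omega>. (\<Sum>i<n. X i \<omega>) / s)) t = char \<nu> (t / s) ^ n"
proof -
  have [measurable]: "random_variable borel (X i)" if "i < n" for i
    using ind that unfolding indep_vars_def2 by simp
  have c: "char (distr M borel (\<lambda>\<omega>. X i \<omega> / s)) t = char \<nu> (t / s)" if "i < n" for i
  proof -
    have "(\<lambda>\<omega>. X i \<omega> / s) \<in> borel_measurable M" using that by measurable
    then show ?thesis using that
      unfolding char_def d[OF that, symmetric] by (simp add: integral_distr)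
  qed
  have "char (distr M borel (\<lambda>\<omega>. (\<Sum>i<n. X i \<omega>) / s)) t
      = char (distr M borel (\<lambda>\<omega>. \<Sum>i<n. X i \<omega> / s)) t"
    by (simp add: sum_divide_distrib)
  also have "\<dots> = (\<Prod>i<n. char (distr M borel (\<lambda>\<omega>. X i \<omega> / s)) t)"
    by (rule char_distr_sum) (rule indep_vars_compose2[OF ind], simp)
  also have "\<dots> = char \<nu> (t / s) ^ n" by (simp add: c)
  finally show ?thesis .
qed

text \<open>
  The library's central limit theorem concerns one sequence on one space. On the level of
  characteristic functions its conclusion depends on the common law only, so it transfers to
  the spaces \<open>M n\<close>, which vary with \<open>n\<close>.
\<close>
lemma char_power_tendsto_normal:
  assumes \<nu>: "real_distribution \<nu>" and \<sigma>: "\<sigma> > 0"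
    and mean: "integral\<^sup>L \<nu> (\<lambda>x. x) = 0"
    and sq: "integrable \<nu> (\<lambda>x. x\<^sup>2)" "integral\<^sup>L \<nu> (\<lambda>x. x\<^sup>2) = \<sigma>\<^sup>2"
  shows "(\<lambda>n. char \<nu> (t / sqrt (real n * \<sigma>\<^sup>2)) ^ n) \<longlonglongrightarrow> char std_normal_distribution t"
proof -
  interpret \<nu>: real_distribution \<nu> by (rule \<nu>)
  \<comment> \<open>The coordinates of an infinite product of copies of \<open>\<nu>\<close> are an
    i.i.d. sequence with law \<open>\<nu>\<close>, to which the central limit theorem
    applies.\<close>
  define P where "P = PiM (UNIV :: nat set) (\<lambda>_. \<nu>)"
  interpret P: product_prob_space "\<lambda>_. \<nu>" "UNIV :: nat set" ..
  interpret prob_space P unfolding P_def by (rule P.prob_space_axioms)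
  have m[measurable]: "(\<lambda>\<omega>. \<omega> i) \<in> measurable P borel" for i
    unfolding P_def by measurable
  have d: "distr P borel (\<lambda>\<omega>. \<omega> i) = \<nu>" for i
  proof -
    have "distr P borel (\<lambda>\<omega>. \<omega> i) = distr P \<nu> (\<lambda>\<omega>. \<omega> i)" by (rule distr_cong) auto
    also have "\<dots> = \<nu>" unfolding P_def by (rule P.PiM_component) simp
    finally show ?thesis .
  qed
  have ind: "indep_vars (\<lambda>_. borel) (\<lambda>i \<omega>. \<omega> i) UNIV"
  proof (subst indep_vars_iff_distr_eq_PiM)
    have "distr P (PiM UNIV (\<lambda>_. borel)) (\<lambda>x. \<lambda>i\<in>UNIV. x i) = distr P P (\<lambda>x. x)"
      by (rule distr_cong) (auto simp: P_def intro!: sets_PiM_cong)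
    then show "distr P (PiM UNIV (\<lambda>_. borel)) (\<lambda>x. \<lambda>i\<in>UNIV. x i) = PiM UNIV (\<lambda>i. distr P borel (\<lambda>\<omega>. \<omega> i))"
      unfolding d by (simp add: distr_id P_def)
  qed auto
  have 0: "expectation (\<lambda>\<omega>. \<omega> i) = 0" for i
    using mean by (subst (asm) d[of i, symmetric]) (simp add: integral_distr)
  have 2: "integrable P (\<lambda>\<omega>. (\<omega> i)\<^sup>2)" for i
    using sq(1) by (subst (asm) d[of i, symmetric]) (simp add: integrable_distr_eq)
  have 3: "expectation (\<lambda>\<omega>. (\<omega> i)\<^sup>2) = \<sigma>\<^sup>2" for i
    using sq(2) by (subst (asm) d[of i, symmetric]) (simp add: integral_distr)
  have "weak_conv_m (\<lambda>n. distr P borel (\<lambda>\<omega>. (\<Sum>i<n. \<omega> i) / sqrt (real n * \<sigma>\<^sup>2))) std_normal_distribution"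
    by (rule central_limit_theorem_zero_mean[OF ind 0 \<sigma> 2 _ d]) (simp add: 0 3)
  from levy_continuity1[OF _ _ this, of t]
  have "(\<lambda>n. char (distr P borel (\<lambda>\<omega>. (\<Sum>i<n. \<omega> i) / sqrt (real n * \<sigma>\<^sup>2))) t)
      \<longlonglongrightarrow> char std_normal_distribution t"
    by (auto intro: real_dist_normal_dist)
  moreover have "char (distr P borel (\<lambda>\<omega>. (\<Sum>i<n. \<omega> i) / s)) t = char \<nu> (t / s) ^ n" for n s
    by (rule char_distr_iid_sum[OF indep_vars_subset[OF ind] d]) auto
  ultimately show ?thesis by simp
qed


section \<open>Mean and variance of the carry\<close>

text \<open>Write the quotient as sum minus remainder, divided by \<open>N\<close>. Centring all
  \<open>n\<close> summands and the remainder at \<open>(N - 1) / 2\<close> subtracts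
  \<open>(n - 1) * (N - 1) / (2 * N)\<close> in total, which is \<open>carry_mean\<close>.\<close>

lemma carry_centred:
  fixes D :: "nat \<Rightarrow> nat \<Rightarrow> 'a \<Rightarrow> nat" and j :: nat
  assumes "b > 0"
  defines "X \<equiv> \<lambda>i \<omega>. \<Sum>k\<in>{1..j}. D i k \<omega> * b ^ (k - 1)" and "N \<equiv> b ^ j"
  shows "rcarry b n D j \<omega> - carry_mean b n j =
    ((\<Sum>i<n. real (X i \<omega>) - (real N - 1) / 2)
      - (real ((\<Sum>i<n. X i \<omega>) mod N) - (real N - 1) / 2)) / real N"
proof -
  have N: "real N > 0" using assms by simp
  have "rcarry b n D j \<omega> = real ((\<Sum>i<n. X i \<omega>) div N)"
    unfolding rcarry_def X_def N_def by (subst carry_eq_div[OF assms(1)]) simp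
  also have "\<dots> = (real (\<Sum>i<n. X i \<omega>) - real ((\<Sum>i<n. X i \<omega>) mod N)) / real N"
    using N by (simp add: field_simps flip: of_nat_mult of_nat_add of_nat_sum)
  finally have 1: "rcarry b n D j \<omega> = \<dots>" .
  have 2: "carry_mean b n j = (real n - 1) / 2 * (1 - 1 / real N)"
    by (simp add: carry_mean_def N_def)
  have 3: "(\<Sum>i<n. real (X i \<omega>) - c) = real (\<Sum>i<n. X i \<omega>) - real n * c" for c
    by (simp add: sum_subtractf)
  show ?thesis
    unfolding 1 2 3 using N by (simp add: field_simps)
qed

text \<open>Displays the variance as \<open>n + 1\<close> times that of a uniform variable on
  \<open>{..<b ^ j}\<close>, scaled by the square of \<open>b ^ j\<close>.\<close>

lemma carry_var_eq:
  assumes "b > 0"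
  shows "carry_var b n j = (real n + 1) * (((real (b ^ j))\<^sup>2 - 1) / 12) / (real (b ^ j))\<^sup>2"
  using assms by (simp add: carry_var_def field_simps power_mult power2_eq_square power_add mult_2)

lemma uniform_rv_centred_moments:
  assumes X: "uniform_rv M {..<N} X" and N: "N > 0"
  defines "c \<equiv> (real N - 1) / 2"
  shows "integrable M (\<lambda>\<omega>. real (X \<omega>) - c)"
    and "integrable M (\<lambda>\<omega>. (real (X \<omega>) - c)\<^sup>2)"
    and "integral\<^sup>L M (\<lambda>\<omega>. real (X \<omega>) - c) = 0"
    and "integral\<^sup>L M (\<lambda>\<omega>. (real (X \<omega>) - c)\<^sup>2) = ((real N)\<^sup>2 - 1) / 12"
proof -
  have ne: "{..<N} \<noteq> {}" using N by auto
  note E = uniform_rv_expectation[OF X finite_lessThan ne]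
  show "integrable M (\<lambda>\<omega>. real (X \<omega>) - c)" "integrable M (\<lambda>\<omega>. (real (X \<omega>) - c)\<^sup>2)"
    by (rule E)+
  show "integral\<^sup>L M (\<lambda>\<omega>. real (X \<omega>) - c) = 0"
    by (subst E(2)) (simp add: c_def sum_centred)
  show "integral\<^sup>L M (\<lambda>\<omega>. (real (X \<omega>) - c)\<^sup>2) = ((real N)\<^sup>2 - 1) / 12"
    using N by (subst E(2)) (simp add: c_def sum_centred_squares)
qed

text \<open>The sum over the square factors into two centred sums, both zero.\<close>

lemma uniform_rv_pair_uncorrelated:
  assumes XY: "uniform_rv M ({..<N} \<times> {..<N}) (\<lambda>\<omega>. (X \<omega>, Y \<omega>))" and N: "N > 0"
  defines "c \<equiv> (real N - 1) / 2"
  shows "integrable M (\<lambda>\<omega>. (real (X \<omega>) - c) * (real (Y \<omega>) - c))"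
    and "integral\<^sup>L M (\<lambda>\<omega>. (real (X \<omega>) - c) * (real (Y \<omega>) - c)) = 0"
proof -
  have ne: "{..<N} \<times> {..<N} \<noteq> {}" using N by auto
  note E = uniform_rv_expectation[OF XY _ ne, where f = "\<lambda>(x, y). (real x - c) * (real y - c)", simplified]
  show "integrable M (\<lambda>\<omega>. (real (X \<omega>) - c) * (real (Y \<omega>) - c))" by (rule E)
  have "(\<Sum>(x, y)\<in>{..<N} \<times> {..<N}. (real x - c) * (real y - c)) = (\<Sum>x<N. real x - c) * (\<Sum>y<N. real y - c)"
    by (simp add: sum_product sum.cartesian_product)
  also have "\<dots> = 0" by (simp add: c_def sum_centred)
  finally show "integral\<^sup>L M (\<lambda>\<omega>. (real (X \<omega>) - c) * (real (Y \<omega>) - c)) = 0"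
    by (simp add: E(2))
qed

text \<open>The centred carry is the sum of the \<open>A i\<close> minus \<open>B\<close>, over
  \<open>N\<close>. These \<open>n + 1\<close> variables have mean 0, second moment \<open>v\<close>
  and vanishing mixed moments.\<close>

lemma carry_moments:
  assumes ud: "uniform_digits b n m M D" and b: "b > 0" and n: "n \<ge> 2" and j: "j \<le> m"
  shows "prob_space.expectation M (rcarry b n D j) = carry_mean b n j"
    and "prob_space.variance M (rcarry b n D j) = carry_var b n j"
proof -
  define X where "X = (\<lambda>i \<omega>. \<Sum>k\<in>{1..j}. D i k \<omega> * b ^ (k - 1))"
  define N where "N = b ^ j"
  define c where "c = (real N - 1) / 2"
  define v where "v = ((real N)\<^sup>2 - 1) / 12"
  define R where "R = (\<lambda>\<omega>. (\<Sum>i<n. X i \<omega>) mod N)"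
  define A where "A = (\<lambda>i \<omega>. real (X i \<omega>) - c)"
  define B where "B = (\<lambda>\<omega>. real (R \<omega>) - c)"
  note rows = uniform_digits_rows[OF ud b j, folded X_def N_def]
  have N: "N > 0" using b by (simp add: N_def)
  have ne: "{..<N} \<noteq> {}" "{..<n} \<noteq> {}" using N n by (auto simp: lessThan_empty_iff)
  interpret prob_space M by (rule rows)
  have X: "uniform_rv M {..<N} (X i)" if "i \<in> {..<n}" for i
    using rows(3) that by (simp add: X_def)
  have R: "uniform_rv M {..<N} R"
    unfolding R_def by (rule uniform_rv_sum_mod(1)[OF rows(1,2) X finite_lessThan ne(2) order_refl N])
  have XR: "uniform_rv M ({..<N} \<times> {..<N}) (\<lambda>\<omega>. (X i \<omega>, R \<omega>))" if "i < n" for i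
  proof -
    \<comment> \<open>Here \<open>n \<ge> 2\<close> enters: some summand other than
      \<open>X i\<close> must randomize \<open>R\<close>.\<close>
    have "{..<n} \<noteq> {i}" using n by (metis card_lessThan card_1_singleton_iff One_nat_def Suc_1 Suc_n_not_le_n)
    then show ?thesis
      unfolding R_def
      by (intro uniform_rv_sum_mod(2)[OF rows(1,2) X finite_lessThan ne(2) order_refl N]) (use that in auto)
  qed
  have XX: "uniform_rv M ({..<N} \<times> {..<N}) (\<lambda>\<omega>. (X i \<omega>, X l \<omega>))" if "i < n" "l < n" "i \<noteq> l" for i l
  proof -
    have "indep_var (count_space UNIV) (\<lambda>\<omega>. (restrict (\<lambda>i. X i \<omega>) {i}) i)
            (count_space UNIV) (\<lambda>\<omega>. (restrict (\<lambda>i. X i \<omega>) {l}) l)"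
      by (rule indep_var_groups[OF rows(2), where f = "\<lambda>x. x i" and g = "\<lambda>x. x l"]) (use that in auto)
    then show ?thesis
      by (intro uniform_rv_pair rows(1) X) (use that ne in auto)
  qed
  have mA: "integrable M (A i)" "integrable M (\<lambda>\<omega>. (A i \<omega>)\<^sup>2)" "expectation (A i) = 0"
    "expectation (\<lambda>\<omega>. (A i \<omega>)\<^sup>2) = v" if "i < n" for i
    using uniform_rv_centred_moments[OF X N, of i] that by (simp_all add: A_def[abs_def] c_def v_def)
  have mB: "integrable M B" "integrable M (\<lambda>\<omega>. (B \<omega>)\<^sup>2)" "expectation B = 0"
    "expectation (\<lambda>\<omega>. (B \<omega>)\<^sup>2) = v"
    using uniform_rv_centred_moments[OF R N] by (simp_all add: B_def[abs_def] c_def v_def)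
  have AB: "integrable M (\<lambda>\<omega>. A i \<omega> * B \<omega>)" "expectation (\<lambda>\<omega>. A i \<omega> * B \<omega>) = 0" if "i < n" for i
    using uniform_rv_pair_uncorrelated[OF XR[OF that] N] by (simp_all add: A_def B_def c_def)
  have AA: "integrable M (\<lambda>\<omega>. A i \<omega> * A l \<omega>)"
    "expectation (\<lambda>\<omega>. A i \<omega> * A l \<omega>) = (if i = l then v else 0)" if "i < n" "l < n" for i l
    using uniform_rv_pair_uncorrelated[OF XX[of i l] N] mA[OF that(1)] that
    by (auto simp: A_def c_def power2_eq_square)
  have K: "rcarry b n D j \<omega> = carry_mean b n j + ((\<Sum>i<n. A i \<omega>) - B \<omega>) / real N" for \<omega>
    using carry_centred[OF b, of n D j \<omega>] unfolding A_def B_def R_def X_def c_def N_def by simp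
  have mean0: "expectation (\<lambda>\<omega>. (\<Sum>i<n. A i \<omega>) - B \<omega>) = 0"
    by (subst Bochner_Integration.integral_diff) (auto simp: mA mB)
  have int: "integrable M (\<lambda>\<omega>. (\<Sum>i<n. A i \<omega>) - B \<omega>)"
    by (intro Bochner_Integration.integrable_diff Bochner_Integration.integrable_sum mA mB) auto
  show mean: "expectation (rcarry b n D j) = carry_mean b n j"
    unfolding K[abs_def] by (subst Bochner_Integration.integral_add) (auto simp: int mean0 prob_space)
  have "((\<Sum>i<n. A i \<omega>) - B \<omega>)\<^sup>2 = (\<Sum>i<n. \<Sum>l<n. A i \<omega> * A l \<omega>) - 2 * (\<Sum>i<n. A i \<omega> * B \<omega>) + (B \<omega>)\<^sup>2" for \<omega>
  proof -
    have "(\<Sum>i<n. A i \<omega>)\<^sup>2 = (\<Sum>i<n. \<Sum>l<n. A i \<omega> * A l \<omega>)"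
      unfolding power2_eq_square by (rule sum_product)
    moreover have "(\<Sum>i<n. A i \<omega>) * B \<omega> = (\<Sum>i<n. A i \<omega> * B \<omega>)"
      by (rule sum_distrib_right)
    ultimately show ?thesis by (simp add: power2_diff mult.assoc)
  qed
  then have "expectation (\<lambda>\<omega>. ((\<Sum>i<n. A i \<omega>) - B \<omega>)\<^sup>2)
      = expectation (\<lambda>\<omega>. (\<Sum>i<n. \<Sum>l<n. A i \<omega> * A l \<omega>) - 2 * (\<Sum>i<n. A i \<omega> * B \<omega>) + (B \<omega>)\<^sup>2)"
    by simp
  also have "\<dots> = (\<Sum>i<n. \<Sum>l<n. if i = l then v else 0) - 2 * (\<Sum>i<n. 0) + v"
  proof -
    have 1: "integrable M (\<lambda>\<omega>. \<Sum>l<n. A i \<omega> * A l \<omega>)"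
      "expectation (\<lambda>\<omega>. \<Sum>l<n. A i \<omega> * A l \<omega>) = (\<Sum>l<n. if i = l then v else 0)" if "i < n" for i
      using AA[OF that] by (auto simp: Bochner_Integration.integral_sum)
    then have 2: "integrable M (\<lambda>\<omega>. \<Sum>i<n. \<Sum>l<n. A i \<omega> * A l \<omega>)"
      "expectation (\<lambda>\<omega>. \<Sum>i<n. \<Sum>l<n. A i \<omega> * A l \<omega>) = (\<Sum>i<n. \<Sum>l<n. if i = l then v else 0)"
      by (auto simp: Bochner_Integration.integral_sum simp del: sum.delta sum.delta')
    have 3: "integrable M (\<lambda>\<omega>. \<Sum>i<n. A i \<omega> * B \<omega>)"
      "expectation (\<lambda>\<omega>. \<Sum>i<n. A i \<omega> * B \<omega>) = (\<Sum>i<n. 0)"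
      using AB by (auto simp: Bochner_Integration.integral_sum)
    show ?thesis by (simp add: 2 3 mB del: sum.delta sum.delta' sum.neutral_const)
  qed
  \<comment> \<open>The diagonal of the double sum gives \<open>n * v\<close>, and the remainder
    \<open>B\<close> one more \<open>v\<close>.\<close>
  also have "\<dots> = (real n + 1) * v" by (simp add: algebra_simps)
  finally have sq: "expectation (\<lambda>\<omega>. ((\<Sum>i<n. A i \<omega>) - B \<omega>)\<^sup>2) = (real n + 1) * v" .
  show "variance (rcarry b n D j) = carry_var b n j"
    unfolding mean carry_var_eq[OF b] N_def[symmetric] v_def[symmetric]
    by (simp add: K power_divide sq)
qed

section \<open>Asymptotic normality of the normalized carry\<close>

text \<open>Reconciles the \<open>n\<close> summands with the normalisation by \<open>n + 1\<close> in the variance.\<close>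
lemma tendsto_power_pred:
  fixes a :: "nat \<Rightarrow> 'a :: real_normed_field"
  assumes "(\<lambda>n. a n ^ Suc n) \<longlonglongrightarrow> L" "a \<longlonglongrightarrow> 1"
  shows "(\<lambda>n. a n ^ n) \<longlonglongrightarrow> L"
proof -
  have "(\<lambda>n. a n ^ Suc n / a n) \<longlonglongrightarrow> L / 1" by (intro tendsto_divide assms) auto
  moreover have "\<forall>\<^sub>F n in sequentially. a n \<noteq> 0"
    using assms(2) by (rule tendsto_imp_eventually_ne) auto
  then have "\<forall>\<^sub>F n in sequentially. a n ^ Suc n / a n = a n ^ n"
    by eventually_elim auto
  ultimately show ?thesis by (simp add: filterlim_cong)
qed

text \<open>Dropping the remainder from \<open>Y\<close> leaves a normalized i.i.d. sum
  \<open>Z\<close>, whose characteristic function is the power shown. The error is at most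
  \<open>N / s\<close> pointwise, and \<open>s\<close> grows like the square root of
  \<open>n\<close> when \<open>N > 1\<close>.\<close>

lemma normalized_carry_char:
  assumes ud: "uniform_digits b n m M D" and b: "b \<ge> 2" and n: "n > 0" and j: "1 \<le> j" "j \<le> m"
  defines "Y \<equiv> \<lambda>\<omega>. (rcarry b n D j \<omega> - carry_mean b n j) / sqrt (carry_var b n j)"
  defines "N \<equiv> b ^ j"
  defines "s \<equiv> sqrt ((real n + 1) * (((real N)\<^sup>2 - 1) / 12))"
  defines "\<nu> \<equiv> distr (pmf_of_set {..<N}) borel (\<lambda>x. real x - (real N - 1) / 2)"
  shows "real_distribution (distr M borel Y)"
    and "cmod (char (distr M borel Y) t - char \<nu> (t / s) ^ n) \<le> \<bar>t\<bar> * (real N / s)"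
proof -
  define X where "X = (\<lambda>i \<omega>. \<Sum>k\<in>{1..j}. D i k \<omega> * b ^ (k - 1))"
  define c where "c = (real N - 1) / 2"
  define R where "R = (\<lambda>\<omega>. (\<Sum>i<n. X i \<omega>) mod N)"
  have b0: "b > 0" using b by simp
  note rows = uniform_digits_rows[OF ud b0 j(2), folded X_def N_def]
  interpret prob_space M by (rule rows)
  have N: "N > 0" using b by (simp add: N_def)
  have Xu: "uniform_rv M {..<N} (X i)" if "i \<in> {..<n}" for i
    using rows(3) that by (simp add: X_def)
  then have X: "X i \<in> measurable M (count_space UNIV)" "distr M (count_space UNIV) (X i) = pmf_of_set {..<N}"
    if "i < n" for i using that by (auto simp: uniform_rv_def)
  have Xb[measurable]: "(\<lambda>\<omega>. real (X i \<omega>)) \<in> borel_measurable M" if "i < n" for i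
    by (rule measurable_compose[OF X(1)[OF that]]) simp
  have "{..<n} \<noteq> {}" using n by auto
  then have "uniform_rv M {..<N} R"
    unfolding R_def by (intro uniform_rv_sum_mod(1)[OF rows(1,2) Xu finite_lessThan _ order_refl N])
  then have Rb[measurable]: "(\<lambda>\<omega>. real (R \<omega>)) \<in> borel_measurable M"
    by (rule measurable_compose[OF uniform_rv_measurable]) simp
  have Y: "Y \<omega> = ((\<Sum>i<n. real (X i \<omega>) - c) - (real (R \<omega>) - c)) / s" for \<omega>
  proof -
    \<comment> \<open>The factor \<open>1 / N\<close> occurs both in the centred carry and in its
      standard deviation, so it cancels.\<close>
    have "sqrt (carry_var b n j) = s / real N"
      unfolding carry_var_eq[OF b0] s_def N_def[symmetric] real_sqrt_divide by simp
    moreover have "rcarry b n D j \<omega> - carry_mean b n j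
        = ((\<Sum>i<n. real (X i \<omega>) - c) - (real (R \<omega>) - c)) / real N"
      using carry_centred[OF b0, of n D j \<omega>] unfolding X_def R_def c_def N_def .
    ultimately show ?thesis using N unfolding Y_def by simp
  qed
  define Z where "Z = (\<lambda>\<omega>. (\<Sum>i<n. real (X i \<omega>) - c) / s)"
  have Zb: "random_variable borel Z"
    unfolding Z_def by (intro borel_measurable_divide borel_measurable_sum borel_measurable_diff Xb) auto
  have Yb: "random_variable borel Y"
    unfolding Y[abs_def]
    by (intro borel_measurable_divide borel_measurable_sum borel_measurable_diff Xb Rb) auto
  show "real_distribution (distr M borel Y)" using Yb by simp
  have "distr M borel (\<lambda>\<omega>. real (X i \<omega>) - c) = \<nu>" if "i < n" for i
    unfolding \<nu>_def X(2)[OF that, symmetric] using X(1)[OF that]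
    by (subst distr_distr) (auto simp: comp_def c_def)
  moreover have "indep_vars (\<lambda>_. borel) (\<lambda>i \<omega>. real (X i \<omega>) - c) {..<n}"
    by (rule indep_vars_compose2[OF rows(2)]) auto
  ultimately have Zc: "char (distr M borel Z) t = char \<nu> (t / s) ^ n"
    unfolding Z_def by (intro char_distr_iid_sum) auto
  have "1 \<le> (real N)\<^sup>2" using N by simp
  then have s: "s \<ge> 0" unfolding s_def by simp
  have "\<bar>Y \<omega> - Z \<omega>\<bar> \<le> real N / s" for \<omega>
  proof -
    have "R \<omega> < N" using N by (simp add: R_def)
    \<comment> \<open>A crude bound suffices: \<open>R\<close> and \<open>c\<close> both lie between
      0 and \<open>N\<close>.\<close>
    then have "\<bar>real (R \<omega>) - c\<bar> \<le> real N" using N unfolding c_def by (simp add: field_simps abs_le_iff)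
    moreover have "Y \<omega> - Z \<omega> = - (real (R \<omega>) - c) / s" unfolding Y Z_def by (simp add: diff_divide_distrib)
    ultimately show ?thesis using s by (simp add: divide_right_mono)
  qed
  from char_distr_diff_le[OF Yb Zb this, of t]
  show "cmod (char (distr M borel Y) t - char \<nu> (t / s) ^ n) \<le> \<bar>t\<bar> * (real N / s)"
    by (simp add: Zc)
qed

text \<open>At each continuity point this is convergence of a real sequence, which finitely many
  initial terms do not affect.\<close>

lemma weak_conv_m_offset:
  assumes "weak_conv_m (\<lambda>n. M (n + k)) M'"
  shows "weak_conv_m M M'"
  unfolding weak_conv_m_def weak_conv_def
proof (intro allI impI)
  fix x assume "isCont (cdf M') x"
  then have "(\<lambda>n. cdf (M (n + k)) x) \<longlonglongrightarrow> cdf M' x"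
    using assms by (simp add: weak_conv_m_def weak_conv_def)
  then show "(\<lambda>n. cdf (M n) x) \<longlonglongrightarrow> cdf M' x" by (rule LIMSEQ_offset)
qed

text \<open>The characteristic function of \<open>Y n\<close> differs by a null sequence from a
  power of that of \<open>\<nu>\<close>. The power converges by the central limit theorem, and Levy
  continuity turns this into weak convergence.\<close>

lemma carry_weak_conv:
  assumes ud: "\<And>n. n \<ge> 2 \<Longrightarrow> uniform_digits b n m (M n) (D n)" and b: "b \<ge> 2" and j: "1 \<le> j" "j \<le> m"
  shows "weak_conv_m
           (\<lambda>n. distr (M n) borel
              (\<lambda>\<omega>. (rcarry b n (D n) j \<omega> - carry_mean b n j) / sqrt (carry_var b n j)))
           std_normal_distribution"
proof -
  define N where "N = b ^ j"
  define v where "v = ((real N)\<^sup>2 - 1) / 12"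
  define \<nu> where "\<nu> = distr (pmf_of_set {..<N}) borel (\<lambda>x. real x - (real N - 1) / 2)"
  define Y where "Y = (\<lambda>n. distr (M n) borel
              (\<lambda>\<omega>. (rcarry b n (D n) j \<omega> - carry_mean b n j) / sqrt (carry_var b n j)))"
  \<comment> \<open>Uses \<open>j \<ge> 1\<close>; for \<open>N = 1\<close> the variance
    \<open>v\<close> would vanish.\<close>
  have "1 < N" unfolding N_def using b j by (intro one_less_power) auto
  then have v: "v > 0" by (simp add: v_def one_less_power)
  \<comment> \<open>The identity on the pmf itself is a uniform variable, so the moments of
    \<open>\<nu>\<close> are those already computed.\<close>
  have U: "uniform_rv (measure_pmf (pmf_of_set {..<N})) {..<N} (\<lambda>x. x)"
    by (simp add: uniform_rv_def flip: map_pmf_rep_eq)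
  have N0: "N > 0" using \<open>1 < N\<close> by simp
  note mom = uniform_rv_centred_moments[OF U N0]
  interpret \<nu>: real_distribution \<nu> unfolding \<nu>_def by (rule prob_space.real_distribution_distr[OF prob_space_measure_pmf]) simp
  have conv: "(\<lambda>n. char \<nu> (t / sqrt (real n * v)) ^ n) \<longlonglongrightarrow> char std_normal_distribution t" for t
    using char_power_tendsto_normal[of \<nu> "sqrt v" t] mom v \<nu>.real_distribution_axioms
    by (simp add: \<nu>_def integrable_distr_eq integral_distr v_def)
  have lim0: "(\<lambda>n. t / sqrt ((real n + 1) * v)) \<longlonglongrightarrow> 0" for t
    using v by real_asymp
  have conv': "(\<lambda>n. char \<nu> (t / sqrt ((real n + 1) * v)) ^ n) \<longlonglongrightarrow> char std_normal_distribution t" for t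
  proof (rule tendsto_power_pred)
    show "(\<lambda>n. char \<nu> (t / sqrt ((real n + 1) * v)) ^ Suc n) \<longlonglongrightarrow> char std_normal_distribution t"
      \<comment> \<open>At index \<open>Suc n\<close> the root contains \<open>real n + 1\<close>,
        as in the normalization by \<open>carry_var\<close>, but the exponent is one too
        large.\<close>
      using LIMSEQ_Suc[OF conv[of t]] by (simp add: add.commute)
    have "(\<lambda>n. char \<nu> (t / sqrt ((real n + 1) * v))) \<longlonglongrightarrow> char \<nu> 0"
      by (rule isCont_tendsto_compose[OF \<nu>.isCont_char lim0])
    then show "(\<lambda>n. char \<nu> (t / sqrt ((real n + 1) * v))) \<longlonglongrightarrow> 1" by (simp add: \<nu>.char_zero)
  qed
  \<comment> \<open>\<open>M 0\<close> and \<open>M 1\<close> are unconstrained, and may fail to be probability spaces.\<close>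
  have "weak_conv_m (\<lambda>n. Y (n + 2)) std_normal_distribution"
  proof (rule levy_continuity)
    fix t
    have "(\<lambda>n. char (Y n) t - char \<nu> (t / sqrt ((real n + 1) * v)) ^ n) \<longlonglongrightarrow> 0"
    proof (rule Lim_null_comparison)
      show "\<forall>\<^sub>F n in sequentially. cmod (char (Y n) t - char \<nu> (t / sqrt ((real n + 1) * v)) ^ n)
              \<le> \<bar>t\<bar> * (real N / sqrt ((real n + 1) * v))"
        unfolding Y_def \<nu>_def v_def N_def
        by (rule eventually_sequentiallyI[of 2], rule normalized_carry_char[OF ud b _ j]) auto
      show "(\<lambda>n. \<bar>t\<bar> * (real N / sqrt ((real n + 1) * v))) \<longlonglongrightarrow> 0"
        by (rule tendsto_mult_right_zero[OF lim0])
    qed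
    then have "(\<lambda>n. char (Y n) t) \<longlonglongrightarrow> char std_normal_distribution t"
      using tendsto_add[OF _ conv'[of t]] by force
    then show "(\<lambda>n. char (Y (n + 2)) t) \<longlonglongrightarrow> char std_normal_distribution t"
      by (rule LIMSEQ_ignore_initial_segment)
  next
    show "real_distribution (Y (n + 2))" for n
      unfolding Y_def by (rule normalized_carry_char(1)[OF ud b _ j]) auto
  qed (rule real_dist_normal_dist)
  then show ?thesis unfolding Y_def by (rule weak_conv_m_offset)
qed

theorem theorem4p1:
  fixes b m :: nat
  assumes "b \<ge> 2" and "m \<ge> 1"
  shows
    "(\<forall>n\<ge>2. \<forall>(M :: 'a measure) D. uniform_digits b n m M D \<longrightarrow>
        (\<forall>j\<in>{1..m}.
           prob_space.expectation M (rcarry b n D j) = carry_mean b n j \<and>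
           prob_space.variance M (rcarry b n D j) = carry_var b n j)) \<and>
     (\<forall>(M :: nat \<Rightarrow> 'b measure) D. (\<forall>n\<ge>2. uniform_digits b n m (M n) (D n)) \<longrightarrow>
        (\<forall>j\<in>{1..m}.
           weak_conv_m
             (\<lambda>n. distr (M n) borel
                (\<lambda>\<omega>. (rcarry b n (D n) j \<omega> - carry_mean b n j) / sqrt (carry_var b n j)))
             std_normal_distribution))"
proof (intro conjI allI impI ballI)
  fix n j :: nat and M :: "'a measure" and D
  assume "n \<ge> 2" "uniform_digits b n m M D" "j \<in> {1..m}"
  then show "prob_space.expectation M (rcarry b n D j) = carry_mean b n j"
    "prob_space.variance M (rcarry b n D j) = carry_var b n j"
    using carry_moments[of b n m M D j] assms(1) by auto
next
  fix M :: "nat \<Rightarrow> 'b measure" and D and j :: nat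
  assume "\<forall>n\<ge>2. uniform_digits b n m (M n) (D n)" "j \<in> {1..m}"
  then show "weak_conv_m
      (\<lambda>n. distr (M n) borel
        (\<lambda>\<omega>. (rcarry b n (D n) j \<omega> - carry_mean b n j) / sqrt (carry_var b n j)))
      std_normal_distribution"
    using carry_weak_conv[of b m M D j] assms(1) by auto
qed

end
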